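(* Let $\mathcal{X}$ and $\mathcal{Y}$ be compact subsets of $\mathbb{R}^p$ and $\mathbb{R}^q$ respectively, and let $\mu\in\mathcal{P}(\mathcal{X})$, $\nu\in\mathcal{P}(\mathcal{Y})$. Assume without loss of generality that $\mathbb{E}_{X\sim\mu}[X]=0$ and $\mathbb{E}_{Y\sim\nu}[Y]=0$. Then the problems $$\inf_{\pi\in\Pi(\mu,\nu)}\iint\big(\|\mathbf{x}-\mathbf{x}'\|_2^2-\|\mathbf{y}-\mathbf{y}'\|_2^2\big)^2d\pi(\mathbf{x},\mathbf{y})\,d\pi(\mathbf{x}',\mathbf{y}')$$ and $$\sup_{\pi\in\Pi(\mu,\nu)}\ \sup_{\mathbf{P}\in\mathbb{R}^{q\times p}}\int\big(\langle\mathbf{P}\mathbf{x},\mathbf{y}\rangle_q+\|\mathbf{x}\|_2^2\|\mathbf{y}\|_2^2\big)d\pi(\mathbf{x},\mathbf{y})-\frac18\|\mathbf{P}\|_F^2$$ are equivalent, i.e. a coupling $\pi^*\in\Pi(\mu,\nu)$ is optimal for the first if and only if it is optimal for the second.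
   Context: $\Pi(\mu,\nu)$ is the set of couplings of $\mu$ and $\nu$, $\|\cdot\|_F$ the Frobenius norm, $\langle\cdot,\cdot\rangle_q$ the Euclidean inner product on $\mathbb{R}^q$. A coupling is optimal for the second problem if it maximizes the function of $\pi$ obtained after taking the supremum over $\mathbf{P}$. *)

theory Defs
  imports "HOL-Probability.Probability"
begin

definition prob_measures_on :: "'a::topological_space set \<Rightarrow> 'a measure set" where
  "prob_measures_on X = {M. prob_space M \<and> sets M = sets (restrict_space borel X)}"

definition couplings :: "'a measure \<Rightarrow> 'b measure \<Rightarrow> ('a \<times> 'b) measure set" where
  "couplings \<mu> \<nu> =
     {\<pi>. prob_space \<pi> \<and> sets \<pi> = sets (\<mu> \<Otimes>\<^sub>M \<nu>) \<and> distr \<pi> \<mu> fst = \<mu> \<and> distr \<pi> \<nu> snd = \<nu>}"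

definition frobenius_norm :: "real ^ 'n ^ 'm \<Rightarrow> real" where
  "frobenius_norm A = sqrt (\<Sum>i\<in>UNIV. \<Sum>j\<in>UNIV. (A $ i $ j)\<^sup>2)"

definition gw_cost :: "('a::real_normed_vector \<times> 'b::real_normed_vector) measure \<Rightarrow> real" where
  "gw_cost \<pi> =
     (LINT (x', y')|\<pi>. (LINT (x, y)|\<pi>. ((norm (x - x'))\<^sup>2 - (norm (y - y'))\<^sup>2)\<^sup>2))"

definition gw_dual_functional ::
    "((real ^ 'p) \<times> (real ^ 'q)) measure \<Rightarrow> real ^ 'p ^ 'q \<Rightarrow> real" where
  "gw_dual_functional \<pi> P =
     (LINT (x, y)|\<pi>. (P *v x) \<bullet> y + (norm x)\<^sup>2 * (norm y)\<^sup>2) - 1 / 8 * (frobenius_norm P)\<^sup>2"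

(* The supremum is taken in the extended reals, where it is always a genuine least upper bound;
   Sup on type real is unspecified on sets that are not bounded above. *)
definition gw_dual_objective :: "((real ^ 'p) \<times> (real ^ 'q)) measure \<Rightarrow> ereal" where
  "gw_dual_objective \<pi> = (SUP P. ereal (gw_dual_functional \<pi> P))"

end

theory Submission imports Defs begin

text \<open>
  Write \<open>A = |x - x'|\<^sup>2\<close>, \<open>B = |y - y'|\<^sup>2\<close> and expand \<open>(A - B)\<^sup>2 = A\<^sup>2 + B\<^sup>2 - 2 A B\<close>. The first two
  terms integrate to constants depending on the marginals only. In the integral of \<open>A B\<close> all terms
  that are linear in one of the centred variables vanish, which leaves
  \<open>2 E |x|\<^sup>2|y|\<^sup>2 + 2 E|x|\<^sup>2 E|y|\<^sup>2 + 4 |M|\<^sub>F\<^sup>2\<close> with \<open>M = E y x\<^sup>T\<close>. On the other side, completing the square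
  shows that the supremum over \<open>P\<close> is attained at \<open>P = 4 M\<close> and equals \<open>E |x|\<^sup>2|y|\<^sup>2 + 2 |M|\<^sub>F\<^sup>2\<close>. Hence the
  first objective is a constant minus four times the second.
\<close>

section \<open>Matrix sums and measures carried by a set\<close>

lemma frobenius_norm_sq: "(frobenius_norm A)\<^sup>2 = (\<Sum>i\<in>UNIV. \<Sum>j\<in>UNIV. (A $ i $ j)\<^sup>2)"
  unfolding frobenius_norm_def by (intro real_sqrt_pow2 sum_nonneg) simp

lemma matrix_vector_inner:
  fixes P :: "real ^ 'p ^ 'q"
  shows "(P *v x) \<bullet> y = (\<Sum>i\<in>UNIV. \<Sum>j\<in>UNIV. P $ i $ j * (y $ i * x $ j))"
  by (simp add: inner_vec_def matrix_vector_mult_def sum_distrib_left sum_distrib_right mult_ac)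

text \<open>The bound is asked only on \<open>space M\<close>: a continuous function is bounded on a
  compact set, but not on the ambient Euclidean space.\<close>

lemma prob_space_integrable_bounded_on_space:
  fixes f :: "'a \<Rightarrow> 'b::{banach, second_countable_topology}"
  assumes "prob_space M" "f \<in> borel_measurable M" "bounded (f ` space M)"
  shows "integrable M f"
proof -
  interpret prob_space M by fact
  obtain B where "\<And>x. x \<in> space M \<Longrightarrow> norm (f x) \<le> B"
    using assms(3) unfolding bounded_iff by auto
  then show ?thesis
    using assms(2) by (intro integrable_const_bound[where B = B] AE_I2)
qed

lemma
  assumes "M \<in> prob_measures_on X"
  shows prob_measures_on_space: "space M = X"
    and prob_measures_on_measurable_id: "(\<lambda>x. x) \<in> borel_measurable M"
proof -
  have *: "sets M = sets (restrict_space borel X)"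
    using assms by (simp add: prob_measures_on_def)
  show "space M = X"
    using sets_eq_imp_space_eq[OF *] by (simp add: space_restrict_space)
  show "(\<lambda>x. x) \<in> borel_measurable M"
    unfolding measurable_cong_sets[OF * refl] by (rule measurable_restrict_space1) simp
qed

text \<open>Fixes one arbitrary coupling, so that the closed forms below can be instantiated at
  every competitor in the final comparison.\<close>

locale compact_coupling =
  fixes X :: "(real ^ 'p) set" and Y :: "(real ^ 'q) set"
    and \<mu> :: "(real ^ 'p) measure" and \<nu> :: "(real ^ 'q) measure"
    and \<pi> :: "((real ^ 'p) \<times> (real ^ 'q)) measure"
  assumes X: "compact X" and Y: "compact Y"
    and \<mu>: "\<mu> \<in> prob_measures_on X" and \<nu>: "\<nu> \<in> prob_measures_on Y"
    and mean_\<mu>: "(LINT x|\<mu>. x) = 0" and mean_\<nu>: "(LINT y|\<nu>. y) = 0"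
    and \<pi>: "\<pi> \<in> couplings \<mu> \<nu>"
begin

section \<open>Measurability, integrability and marginals\<close>

sublocale prob_space \<pi>
  using \<pi> by (simp add: couplings_def)

sublocale pair: pair_prob_space \<pi> \<pi> ..

lemma sets_\<pi>: "sets \<pi> = sets (\<mu> \<Otimes>\<^sub>M \<nu>)"
  using \<pi> by (simp add: couplings_def)

lemma space_\<pi>: "space \<pi> = X \<times> Y"
  using sets_eq_imp_space_eq[OF sets_\<pi>] prob_measures_on_space[OF \<mu>] prob_measures_on_space[OF \<nu>]
  by (simp add: space_pair_measure)

lemma measurable_fst_\<pi>: "fst \<in> measurable \<pi> \<mu>"
  and measurable_snd_\<pi>: "snd \<in> measurable \<pi> \<nu>"
  unfolding measurable_cong_sets[OF sets_\<pi> refl] by simp_all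

lemma measurable_id_\<pi>: "(\<lambda>z. z) \<in> borel_measurable \<pi>"
proof -
  have "fst \<in> borel_measurable \<pi>" "snd \<in> borel_measurable \<pi>"
    using measurable_compose[OF measurable_fst_\<pi> prob_measures_on_measurable_id[OF \<mu>]]
      measurable_compose[OF measurable_snd_\<pi> prob_measures_on_measurable_id[OF \<nu>]] by simp_all
  from borel_measurable_Pair[OF this] show ?thesis by simp
qed

lemma integrable_continuous:
  fixes f :: "(real ^ 'p) \<times> (real ^ 'q) \<Rightarrow> 'c::{banach, second_countable_topology}"
  assumes "continuous_on UNIV f"
  shows "integrable \<pi> f"
proof (rule prob_space_integrable_bounded_on_space)
  show "f \<in> borel_measurable \<pi>"
    using measurable_compose[OF measurable_id_\<pi> borel_measurable_continuous_onI[OF assms]] .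
  have "compact (f ` (X \<times> Y))"
    by (intro compact_continuous_image compact_Times X Y continuous_on_subset[OF assms]) simp
  then show "bounded (f ` space \<pi>)"
    unfolding space_\<pi> by (rule compact_imp_bounded)
qed (fact prob_space_axioms)

text \<open>Fubini for the bounded integrand on the product of \<pi> with itself; this is what
  allows the outer integral of the cost to be split by linearity.\<close>

lemma integrable_continuous_integral:
  fixes f :: "((real ^ 'p) \<times> (real ^ 'q)) \<times> ((real ^ 'p) \<times> (real ^ 'q)) \<Rightarrow> real"
  assumes "continuous_on UNIV f"
  shows "integrable \<pi> (\<lambda>w. LINT z|\<pi>. f (w, z))"
proof -
  have id: "(\<lambda>p. p) \<in> borel_measurable (\<pi> \<Otimes>\<^sub>M \<pi>)"
    using borel_measurable_Pair[OF measurable_compose[OF measurable_fst measurable_id_\<pi>]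
        measurable_compose[OF measurable_snd measurable_id_\<pi>]] by simp
  have "integrable (\<pi> \<Otimes>\<^sub>M \<pi>) f"
  proof (rule prob_space_integrable_bounded_on_space)
    show "f \<in> borel_measurable (\<pi> \<Otimes>\<^sub>M \<pi>)"
      using measurable_compose[OF id borel_measurable_continuous_onI[OF assms]] .
    have "compact (f ` ((X \<times> Y) \<times> (X \<times> Y)))"
      by (intro compact_continuous_image compact_Times X Y continuous_on_subset[OF assms]) simp
    then show "bounded (f ` space (\<pi> \<Otimes>\<^sub>M \<pi>))"
      unfolding space_pair_measure space_\<pi> by (rule compact_imp_bounded)
  qed (fact pair.prob_space_axioms)
  then show ?thesis
    by (rule pair.integrable_fst')
qed

lemma integral_fst:
  fixes f :: "real ^ 'p \<Rightarrow> 'c::{banach, second_countable_topology}"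
  assumes "f \<in> borel_measurable \<mu>"
  shows "(LINT z|\<pi>. f (fst z)) = (LINT x|\<mu>. f x)"
  using integral_distr[OF measurable_fst_\<pi> assms] \<pi> by (simp add: couplings_def)

lemma integral_snd:
  fixes f :: "real ^ 'q \<Rightarrow> 'c::{banach, second_countable_topology}"
  assumes "f \<in> borel_measurable \<nu>"
  shows "(LINT z|\<pi>. f (snd z)) = (LINT y|\<nu>. f y)"
  using integral_distr[OF measurable_snd_\<pi> assms] \<pi> by (simp add: couplings_def)

section \<open>Moments of a coupling\<close>

lemma mean_fst: "(LINT z|\<pi>. fst z) = 0"
  using integral_fst[OF prob_measures_on_measurable_id[OF \<mu>]] unfolding mean_\<mu> .

lemma mean_snd: "(LINT z|\<pi>. snd z) = 0"
  using integral_snd[OF prob_measures_on_measurable_id[OF \<nu>]] unfolding mean_\<nu> .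

text \<open>The matrix E[y x^T], the cross-covariance since both means vanish. It has the shape of
  \<open>P\<close>, so <P x, y> integrates to the Frobenius inner product of \<open>P\<close> with
  it.\<close>

definition cross_moment :: "real ^ 'p ^ 'q" where
  "cross_moment = (\<chi> i j. LINT z|\<pi>. snd z $ i * fst z $ j)"

definition sq_moment :: real where
  "sq_moment = (LINT z|\<pi>. (norm (fst z))\<^sup>2 * (norm (snd z))\<^sup>2)"

lemma integrable_matrix_vector_inner: "integrable \<pi> (\<lambda>z. (P *v fst z) \<bullet> snd z)"
  unfolding matrix_vector_inner by (intro integrable_continuous continuous_intros)

lemma integral_matrix_vector_inner:
  "(LINT z|\<pi>. (P *v fst z) \<bullet> snd z) = (\<Sum>i\<in>UNIV. \<Sum>j\<in>UNIV. P $ i $ j * cross_moment $ i $ j)"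
proof -
  have "integrable \<pi> (\<lambda>z. P $ i $ j * (snd z $ i * fst z $ j))" for i j
    by (intro integrable_continuous continuous_intros)
  then show ?thesis
    by (simp add: matrix_vector_inner cross_moment_def Bochner_Integration.integral_sum
        del: integrable_mult_right_iff)
qed

lemma integral_inner_inner:
  "(LINT z|\<pi>. (fst z \<bullet> x) * (snd z \<bullet> y)) = (cross_moment *v x) \<bullet> y"
proof -
  \<comment> \<open>The rank-one matrix y x^T turns the product into a bilinear form, to which the
    previous formula applies.\<close>
  have *: "(fst z \<bullet> x) * (snd z \<bullet> y) = ((\<chi> i j. y $ i * x $ j) *v fst z) \<bullet> snd z" for z
    unfolding matrix_vector_inner
    by (simp add: inner_vec_def sum_product mult_ac) (rule sum.swap)
  show ?thesis
    unfolding * integral_matrix_vector_inner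
    by (simp add: matrix_vector_inner mult_ac)
qed

text \<open>The inner integral of the mixed term, with (x, y) held fixed. The two third-order moment
  vectors survive here, but they are paired linearly with x and y and so vanish under the outer
  integral.\<close>

lemma integral_sq_dist_mult_sq_dist:
  "(LINT z|\<pi>. (norm (fst z - x))\<^sup>2 * (norm (snd z - y))\<^sup>2) =
     sq_moment + (norm y)\<^sup>2 * (LINT z|\<pi>. (norm (fst z))\<^sup>2) + (norm x)\<^sup>2 * (LINT z|\<pi>. (norm (snd z))\<^sup>2)
     + (norm x)\<^sup>2 * (norm y)\<^sup>2 - 2 * ((LINT z|\<pi>. (norm (fst z))\<^sup>2 *\<^sub>R snd z) \<bullet> y)
     - 2 * ((LINT z|\<pi>. (norm (snd z))\<^sup>2 *\<^sub>R fst z) \<bullet> x) + 4 * ((cross_moment *v x) \<bullet> y)"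
proof -
  let ?a = "\<lambda>z::(real^'p)\<times>(real^'q). (norm (fst z))\<^sup>2" and ?b = "\<lambda>z::(real^'p)\<times>(real^'q). (norm (snd z))\<^sup>2"
  \<comment> \<open>The last two summands are linear in \<open>snd z\<close> or \<open>fst z\<close>
    alone and integrate to zero by centring.\<close>
  have *: "(norm (fst z - x))\<^sup>2 * (norm (snd z - y))\<^sup>2 =
      ?a z * ?b z + (norm y)\<^sup>2 * ?a z + (norm x)\<^sup>2 * ?b z + (norm x)\<^sup>2 * (norm y)\<^sup>2
      - 2 * ((?a z *\<^sub>R snd z) \<bullet> y) - 2 * ((?b z *\<^sub>R fst z) \<bullet> x) + 4 * ((fst z \<bullet> x) * (snd z \<bullet> y))
      - 2 * (norm x)\<^sup>2 * (snd z \<bullet> y) - 2 * (norm y)\<^sup>2 * (fst z \<bullet> x)" for z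
    by (simp add: power2_norm_eq_inner inner_commute algebra_simps)
  have i: "integrable \<pi> (\<lambda>z. ?a z * ?b z)" "integrable \<pi> ?a" "integrable \<pi> ?b"
    "integrable \<pi> (\<lambda>z. ?a z *\<^sub>R snd z)" "integrable \<pi> (\<lambda>z. ?b z *\<^sub>R fst z)"
    "integrable \<pi> (\<lambda>z. (fst z \<bullet> x) * (snd z \<bullet> y))"
    "integrable \<pi> (\<lambda>z. fst z)" "integrable \<pi> (\<lambda>z. snd z)"
    by (intro integrable_continuous continuous_intros)+
  show ?thesis
    unfolding *
    \<comment> \<open>Keeping the scalar inside the inner product lets the fixed vector be pulled
      out of a vector-valued integral.\<close>
    using i by (simp add: sq_moment_def mean_fst mean_snd integral_inner_inner prob_space
        del: inner_scaleR_left)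
qed

section \<open>Closed form of the dual objective\<close>

text \<open>Completing the square: <P, M> - |P|^2/8 = 2|M|^2 - |P - 4M|^2/8 in the Frobenius inner
  product, with M = \<open>cross_moment\<close>.\<close>

lemma gw_dual_functional_eq:
  "gw_dual_functional \<pi> P =
     sq_moment + 2 * (frobenius_norm cross_moment)\<^sup>2 - 1 / 8 * (frobenius_norm (P - 4 *\<^sub>R cross_moment))\<^sup>2"
proof -
  have "integrable \<pi> (\<lambda>z. (norm (fst z))\<^sup>2 * (norm (snd z))\<^sup>2)"
    by (intro integrable_continuous continuous_intros)
  with integrable_matrix_vector_inner[of P] have "gw_dual_functional \<pi> P =
      (\<Sum>i\<in>UNIV. \<Sum>j\<in>UNIV. P $ i $ j * cross_moment $ i $ j) + sq_moment - 1 / 8 * (frobenius_norm P)\<^sup>2"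
    by (simp add: gw_dual_functional_def case_prod_beta' integral_matrix_vector_inner sq_moment_def)
  then show ?thesis
    by (simp add: frobenius_norm_sq sum_distrib_left power2_diff sum.distrib sum_subtractf
        algebra_simps sum_divide_distrib)
qed

lemma gw_dual_objective_eq:
  "gw_dual_objective \<pi> = ereal (sq_moment + 2 * (frobenius_norm cross_moment)\<^sup>2)"
  unfolding gw_dual_objective_def
proof (rule antisym)
  show "(SUP P. ereal (gw_dual_functional \<pi> P)) \<le>
      ereal (sq_moment + 2 * (frobenius_norm cross_moment)\<^sup>2)"
    by (rule SUP_least) (simp add: gw_dual_functional_eq)
  show "ereal (sq_moment + 2 * (frobenius_norm cross_moment)\<^sup>2) \<le>
      (SUP P. ereal (gw_dual_functional \<pi> P))"
    \<comment> \<open>At this matrix the subtracted square is zero, so the upper bound is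
      attained.\<close>
    by (rule SUP_upper2[where i = "4 *\<^sub>R cross_moment"])
      (simp_all add: gw_dual_functional_eq frobenius_norm_def)
qed

section \<open>Closed form of the cost\<close>

lemma gw_cost_eq:
  "gw_cost \<pi> =
     (LINT x'|\<mu>. LINT x|\<mu>. ((norm (x - x'))\<^sup>2)\<^sup>2) + (LINT y'|\<nu>. LINT y|\<nu>. ((norm (y - y'))\<^sup>2)\<^sup>2)
     - 4 * ((LINT x|\<mu>. (norm x)\<^sup>2) * (LINT y|\<nu>. (norm y)\<^sup>2))
     - 4 * (sq_moment + 2 * (frobenius_norm cross_moment)\<^sup>2)"
proof -
  let ?A = "\<lambda>z w::(real^'p)\<times>(real^'q). (norm (fst z - fst w))\<^sup>2"
    and ?B = "\<lambda>z w::(real^'p)\<times>(real^'q). (norm (snd z - snd w))\<^sup>2"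
  have inner: "(LINT z|\<pi>. (?A z w - ?B z w)\<^sup>2) =
      (LINT z|\<pi>. (?A z w)\<^sup>2) + (LINT z|\<pi>. (?B z w)\<^sup>2) - 2 * (LINT z|\<pi>. ?A z w * ?B z w)" for w
  proof -
    have "integrable \<pi> (\<lambda>z. (?A z w)\<^sup>2)" "integrable \<pi> (\<lambda>z. (?B z w)\<^sup>2)"
      "integrable \<pi> (\<lambda>z. ?A z w * ?B z w)"
      by (intro integrable_continuous continuous_intros)+
    then show ?thesis
      by (simp add: power2_diff mult.assoc)
  qed
  have "integrable \<pi> (\<lambda>w. LINT z|\<pi>. (?A z w)\<^sup>2)"
    using integrable_continuous_integral[of "\<lambda>p. (?A (snd p) (fst p))\<^sup>2"]
    by (simp add: continuous_intros)
  moreover have "integrable \<pi> (\<lambda>w. LINT z|\<pi>. (?B z w)\<^sup>2)"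
    using integrable_continuous_integral[of "\<lambda>p. (?B (snd p) (fst p))\<^sup>2"]
    by (simp add: continuous_intros)
  moreover have "integrable \<pi> (\<lambda>w. LINT z|\<pi>. ?A z w * ?B z w)"
    using integrable_continuous_integral[of "\<lambda>p. ?A (snd p) (fst p) * ?B (snd p) (fst p)"]
    by (simp add: continuous_intros)
  ultimately have cost: "gw_cost \<pi> = (LINT w|\<pi>. LINT z|\<pi>. (?A z w)\<^sup>2) + (LINT w|\<pi>. LINT z|\<pi>. (?B z w)\<^sup>2)
      - 2 * (LINT w|\<pi>. LINT z|\<pi>. ?A z w * ?B z w)"
    by (simp add: gw_cost_def case_prod_beta' inner)
  interpret m: prob_space \<mu> using \<mu> by (simp add: prob_measures_on_def)
  interpret n: prob_space \<nu> using \<nu> by (simp add: prob_measures_on_def)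
  note [measurable] = prob_measures_on_measurable_id[OF \<mu>] prob_measures_on_measurable_id[OF \<nu>]
  \<comment> \<open>Only first coordinates occur, so both integrals pass to \<mu> and the value is
    the same for all couplings.\<close>
  have mA: "(LINT w|\<pi>. LINT z|\<pi>. (?A z w)\<^sup>2) = (LINT x'|\<mu>. LINT x|\<mu>. ((norm (x - x'))\<^sup>2)\<^sup>2)"
    by (subst integral_fst, measurable)
      (rule integral_fst[where f = "\<lambda>x'. LINT x|\<mu>. ((norm (x - x'))\<^sup>2)\<^sup>2"], measurable)
  have mB: "(LINT w|\<pi>. LINT z|\<pi>. (?B z w)\<^sup>2) = (LINT y'|\<nu>. LINT y|\<nu>. ((norm (y - y'))\<^sup>2)\<^sup>2)"
    by (subst integral_snd, measurable)
      (rule integral_snd[where f = "\<lambda>y'. LINT y|\<nu>. ((norm (y - y'))\<^sup>2)\<^sup>2"], measurable)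
  have sq: "(LINT z|\<pi>. (norm (fst z))\<^sup>2) = (LINT x|\<mu>. (norm x)\<^sup>2)"
    "(LINT z|\<pi>. (norm (snd z))\<^sup>2) = (LINT y|\<nu>. (norm y)\<^sup>2)"
    by (rule integral_fst integral_snd, measurable)+
  have i: "integrable \<pi> (\<lambda>z. (norm (fst z))\<^sup>2 * (norm (snd z))\<^sup>2)"
    "integrable \<pi> (\<lambda>z. (norm (fst z))\<^sup>2)" "integrable \<pi> (\<lambda>z. (norm (snd z))\<^sup>2)"
    "integrable \<pi> (\<lambda>z. fst z)" "integrable \<pi> (\<lambda>z. snd z)"
    by (intro integrable_continuous continuous_intros)+
  \<comment> \<open>One \<open>sq_moment\<close> is the constant from the inner integral, the other
    comes from |x|^2 |y|^2 at the outer point. The last integral becomes the Frobenius inner product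
    of \<open>cross_moment\<close> with itself.\<close>
  have "(LINT w|\<pi>. LINT z|\<pi>. ?A z w * ?B z w) =
      2 * sq_moment + 2 * ((LINT x|\<mu>. (norm x)\<^sup>2) * (LINT y|\<nu>. (norm y)\<^sup>2)) +
      4 * (LINT z|\<pi>. (cross_moment *v fst z) \<bullet> snd z)"
    unfolding integral_sq_dist_mult_sq_dist
    using i integrable_matrix_vector_inner[of cross_moment]
    by (simp add: mean_fst mean_snd prob_space sq sq_moment_def[symmetric])
  then show ?thesis
    unfolding cost mA mB integral_matrix_vector_inner
    by (simp add: frobenius_norm_sq flip: power2_eq_square)
qed

end

section \<open>Comparison of optimizers\<close>

theorem theorem4p2p5:
  fixes X :: "(real ^ 'p) set" and Y :: "(real ^ 'q) set"
    and \<mu> :: "(real ^ 'p) measure" and \<nu> :: "(real ^ 'q) measure"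
    and \<pi> :: "((real ^ 'p) \<times> (real ^ 'q)) measure"
  assumes "compact X" and "compact Y"
    and "\<mu> \<in> prob_measures_on X" and "\<nu> \<in> prob_measures_on Y"
    and "(LINT x|\<mu>. x) = 0" and "(LINT y|\<nu>. y) = 0"
    and "\<pi> \<in> couplings \<mu> \<nu>"
  shows "is_arg_min gw_cost (\<lambda>\<pi>'. \<pi>' \<in> couplings \<mu> \<nu>) \<pi> \<longleftrightarrow>
         is_arg_max gw_dual_objective (\<lambda>\<pi>'. \<pi>' \<in> couplings \<mu> \<nu>) \<pi>"
proof -
  \<comment> \<open>A single \<open>C\<close> serves all couplings: the witness is built from \<mu>
    and \<nu> alone.\<close>
  obtain C where C: "\<And>\<pi>'. \<pi>' \<in> couplings \<mu> \<nu> \<Longrightarrow> gw_dual_objective \<pi>' = ereal ((C - gw_cost \<pi>') / 4)"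
  proof
    fix \<pi>' assume "\<pi>' \<in> couplings \<mu> \<nu>"
    then interpret compact_coupling X Y \<mu> \<nu> \<pi>'
      using assms by unfold_locales
    show "gw_dual_objective \<pi>' = ereal (((LINT x'|\<mu>. LINT x|\<mu>. ((norm (x - x'))\<^sup>2)\<^sup>2)
        + (LINT y'|\<nu>. LINT y|\<nu>. ((norm (y - y'))\<^sup>2)\<^sup>2)
        - 4 * ((LINT x|\<mu>. (norm x)\<^sup>2) * (LINT y|\<nu>. (norm y)\<^sup>2)) - gw_cost \<pi>') / 4)"
      unfolding gw_dual_objective_eq gw_cost_eq by simp
  qed
  \<comment> \<open>Both optimality notions say that no competitor is strictly better, so reversal
    of strict inequalities under the decreasing affine map suffices.\<close>
  have "gw_cost \<pi>' < gw_cost \<pi> \<longleftrightarrow> gw_dual_objective \<pi> < gw_dual_objective \<pi>'"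
    if "\<pi>' \<in> couplings \<mu> \<nu>" for \<pi>'
    using C[OF that] C[OF assms(7)] by auto
  then show ?thesis
    unfolding is_arg_min_def is_arg_max_def by blast
qed

end
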